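(* Assume $\theta_k > \theta_{k+1}$ and $c < 4\cdot 10^{-4}$. For any (possibly adaptive) algorithm $A$, if $A$ uses $c \sum_{i:\, i\leq k,\ \theta_i \leq 2\theta_{k+1}} \frac{\theta_{k+1}^2}{(\theta_{k+1}- \theta_i)^2}$ comparisons of any size (sets of any size between $2$ and $n$), then $A$ identifies the top-$k$ items with probability at most $7/8$. This holds even if $A$ is given the values $\{\theta_1,\dots,\theta_n\}$.
   Context: MNL model: $n$ items with positive scores $\theta_1\ge\theta_2\ge\cdots\ge\theta_n$; the top-$k$ items are those with scores $\theta_1,\dots,\theta_k$. The algorithm sees the items only via labels given by a uniformly random permutation $\pi$ of $[n]$ (item with score $\theta_i$ has label $\pi_i$); it may know the multiset of score values but not which label carries which score. In each round it chooses (adaptively) a set $S$ of at least two items and observes one item $a\in S$ with probability $\theta_a/\sum_{j\in S}\theta_j$, independently of the past given $S$. Each round is one comparison. Success means outputting $\{\pi_1,\dots,\pi_k\}$; probability is over $\pi$, outcomes and the algorithm's randomness. *)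

theory Defs
  imports "HOL-Probability.Probability" "HOL-Combinatorics.Permutations"
begin

text \<open>Items and labels are both numbered \<open>1, \<dots>, n\<close>; \<open>w j\<close> is the score of the item carrying
  label \<open>j\<close>.\<close>

definition mnl_choice :: "(nat \<Rightarrow> real) \<Rightarrow> nat set \<Rightarrow> nat pmf" where
  "mnl_choice w S = embed_pmf (\<lambda>a. if a \<in> S then w a / (\<Sum>j\<in>S. w j) else 0)"

text \<open>\<^const>\<open>embed_pmf\<close> is meaningful here on every nonempty finite set of positive scores:\<close>

lemma pmf_mnl_choice:
  assumes "finite S" "S \<noteq> {}" "\<And>j. j \<in> S \<Longrightarrow> w j > 0"
  shows "pmf (mnl_choice w S) a = (if a \<in> S then w a / (\<Sum>j\<in>S. w j) else 0)"
proof -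
  have pos: "(\<Sum>j\<in>S. w j) > 0"
    using assms by (intro sum_pos) auto
  let ?f = "\<lambda>a. if a \<in> S then w a / (\<Sum>j\<in>S. w j) else 0"
  have nonneg: "?f x \<ge> 0" for x
    using assms(3)[of x] pos by auto
  have "(\<integral>\<^sup>+x. ennreal (?f x) \<partial>count_space UNIV) = (\<integral>\<^sup>+x. ennreal (?f x) \<partial>count_space S)"
    by (rule nn_integral_count_space_eq) auto
  also have "\<dots> = (\<Sum>x\<in>S. ennreal (?f x))"
    using assms(1) by (rule nn_integral_count_space_finite)
  also have "\<dots> = ennreal (\<Sum>x\<in>S. ?f x)"
    by (rule sum_ennreal) (rule nonneg)
  also have "(\<Sum>x\<in>S. ?f x) = (\<Sum>x\<in>S. w x / (\<Sum>j\<in>S. w j))"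
    by (intro sum.cong) auto
  also have "\<dots> = 1"
    using pos by (simp flip: sum_divide_distrib)
  finally have "(\<integral>\<^sup>+x. ennreal (?f x) \<partial>count_space UNIV) = 1"
    by simp
  then show ?thesis
    unfolding mnl_choice_def using nonneg by (intro pmf_embed_pmf) auto
qed

text \<open>An algorithm decides, from the sets compared and the winners seen so far (oldest first), on
  a possibly randomised next step: another comparison, or stopping with an answer. There are
  finitely many transcripts of bounded length, so by perfect recall this covers every kind of
  internal randomness, including a random seed drawn once and for all at the start.\<close>

type_synonym transcript = "(nat set \<times> nat) list"

datatype step = Compare "nat set" | Answer "nat set"

type_synonym algorithm = "transcript \<Rightarrow> step pmf"

inductive reachable :: "algorithm \<Rightarrow> transcript \<Rightarrow> bool" for A :: algorithm where
  Nil: "reachable A []"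
| snoc: "reachable A h \<Longrightarrow> Compare S \<in> set_pmf (A h) \<Longrightarrow> a \<in> S \<Longrightarrow> reachable A (h @ [(S, a)])"

definition valid_algorithm :: "nat \<Rightarrow> algorithm \<Rightarrow> bool" where
  "valid_algorithm n A \<longleftrightarrow>
     (\<forall>h S. reachable A h \<longrightarrow> Compare S \<in> set_pmf (A h) \<longrightarrow> S \<subseteq> {1..n} \<and> 2 \<le> card S)"

definition uses_at_most :: "algorithm \<Rightarrow> nat \<Rightarrow> bool" where
  "uses_at_most A T \<longleftrightarrow>
     (\<forall>h S. reachable A h \<longrightarrow> Compare S \<in> set_pmf (A h) \<longrightarrow> length h < T)"

text \<open>The distribution of the answer when continuing from transcript \<open>h\<close>. The third argument
  makes the recursion terminate: it is the number of comparisons still allowed, and \<^const>\<open>None\<close>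
  means that the algorithm asked for more. For a valid algorithm with \<^prop>\<open>uses_at_most A T\<close>
  and positive scores, \<^const>\<open>None\<close> never results from \<open>T\<close> allowed comparisons.\<close>

fun run :: "algorithm \<Rightarrow> (nat \<Rightarrow> real) \<Rightarrow> nat \<Rightarrow> transcript \<Rightarrow> nat set option pmf" where
  "run A w 0 h = bind_pmf (A h) (\<lambda>s. case s of
       Answer R \<Rightarrow> return_pmf (Some R)
     | Compare S \<Rightarrow> return_pmf None)"
| "run A w (Suc t) h = bind_pmf (A h) (\<lambda>s. case s of
       Answer R \<Rightarrow> return_pmf (Some R)
     | Compare S \<Rightarrow> bind_pmf (mnl_choice w S) (\<lambda>a. run A w t (h @ [(S, a)])))"

text \<open>The item with score \<open>\<theta> i\<close> gets the label \<open>\<pi> i\<close>, so label \<open>j\<close> carries the score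
  \<open>\<theta> (inv \<pi> j)\<close>.\<close>

definition success_pmf :: "nat \<Rightarrow> nat \<Rightarrow> (nat \<Rightarrow> real) \<Rightarrow> algorithm \<Rightarrow> nat \<Rightarrow> bool pmf" where
  "success_pmf n k \<theta> A T =
     bind_pmf (pmf_of_set {\<pi>. \<pi> permutes {1..n}}) (\<lambda>\<pi>.
       map_pmf (\<lambda>r. r = Some (\<pi> ` {1..k})) (run A (\<lambda>j. \<theta> (inv \<pi> j)) T []))"

end

theory Submission
  imports Defs
begin

text \<open>Lower the score of one top item \<open>i\<close> to \<open>\<theta>\<^sub>k\<^sub>+\<^sub>1\<close>. In the modified model the labels of \<open>i\<close> and
  \<open>k + 1\<close> are exchangeable, so the answer is correct with probability at most \<open>1/2\<close> on average over
  \<open>\<pi>\<close>. Writing \<open>q = \<theta>\<^sub>k\<^sub>+\<^sub>1\<close>, a comparison of \<open>S\<close> contributes to the relative entropy of the true model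
  with respect to the modified one at most \<open>((\<theta>\<^sub>i - q) / q)\<^sup>2\<close> times the probability that \<open>i\<close> wins
  in \<open>S\<close>. Weighting \<open>i\<close> by \<open>(q / (\<theta>\<^sub>i - q))\<^sup>2\<close>, the total contribution of a
  comparison is therefore at most \<open>1\<close>. The variational (Donsker--Varadhan) form of the relative entropy
  turns this into a bound on the success probability.\<close>

section \<open>Exponential moments of an event indicator\<close>

text \<open>This is \<open>ln (E (exp X))\<close> for a Bernoulli variable \<open>X\<close> of mean
  \<open>x\<close>: the term that the Donsker--Varadhan inequality assigns to the indicator of an
  event of probability \<open>x\<close>.\<close>

definition log_mgf :: "real \<Rightarrow> real" where
  "log_mgf x = ln (1 + (exp 1 - 1) * x)"

lemma log_mgf_arg_pos:
  assumes "0 \<le> x"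
  shows "0 < 1 + (exp 1 - 1) * (x :: real)"
proof -
  have "0 \<le> (exp 1 - 1) * x" using assms by (intro mult_nonneg_nonneg) auto
  then show ?thesis by linarith
qed

lemma log_mgf_le:
  assumes "0 \<le> x"
  shows "log_mgf x \<le> (exp 1 - 1) * x"
  using ln_le_minus_one[OF log_mgf_arg_pos[OF assms]] by (simp add: log_mgf_def)

text \<open>On [0, 1] the convex function \<open>exp\<close> lies below its chord. This is the
  change of measure between two equal models, hence the base of the induction over a run.\<close>

lemma log_mgf_ge:
  assumes "0 \<le> x" "x \<le> 1"
  shows "x \<le> log_mgf x"
proof -
  have "exp ((1 - x) *\<^sub>R 0 + x *\<^sub>R 1) \<le> (1 - x) * exp 0 + x * exp (1 :: real)"
    using assms by (intro convex_onD[OF exp_convex]) auto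
  then have "exp x \<le> 1 + (exp 1 - 1) * x"
    by (simp add: algebra_simps)
  then show ?thesis
    using log_mgf_arg_pos[OF assms(1)] by (simp add: log_mgf_def ln_ge_iff)
qed

lemma log_mgf_bounds:
  assumes "0 \<le> x" "x \<le> 1"
  shows "0 \<le> log_mgf x" "log_mgf x \<le> exp 1 - 1"
proof -
  show "0 \<le> log_mgf x" using log_mgf_ge[OF assms] assms by linarith
  have "(exp 1 - 1) * x \<le> (exp 1 - 1) * 1"
    using assms by (intro mult_left_mono) auto
  then show "log_mgf x \<le> exp 1 - 1"
    using log_mgf_le[OF assms(1)] by (simp only: mult_1_right)
qed

lemma log_mgf_tangent:
  assumes "0 \<le> x" "0 \<le> m"
  shows "log_mgf x \<le> log_mgf m + (exp 1 - 1) / (1 + (exp 1 - 1) * m) * (x - m)"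
proof -
  let ?X = "1 + (exp 1 - 1) * x" and ?M = "1 + (exp 1 - 1) * m"
  have pos: "0 < ?X" "0 < ?M" using log_mgf_arg_pos assms by auto
  have "ln (?X / ?M) \<le> ?X / ?M - 1" using pos by (intro ln_le_minus_one divide_pos_pos)
  also have "?X / ?M - 1 = (?X - ?M) / ?M"
    using pos by (simp only: diff_divide_distrib divide_self)
  also have "\<dots> = (exp 1 - 1) / ?M * (x - m)"
    by (simp flip: right_diff_distrib)
  finally show ?thesis using pos by (simp add: log_mgf_def ln_div)
qed

lemma integrable_pmf_bounded:
  fixes f :: "'a \<Rightarrow> real"
  assumes "\<And>s. s \<in> set_pmf p \<Longrightarrow> \<bar>f s\<bar> \<le> C"
  shows "integrable (measure_pmf p) f"
  using assms by (intro measure_pmf.integrable_const_bound[where B = C]) (auto simp: AE_measure_pmf_iff)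

text \<open>Jensen's inequality for the concave \<open>log_mgf\<close>: integrate the tangent at the
  mean, whose linear part has expectation 0.\<close>

lemma expectation_log_mgf_le:
  assumes "\<And>s. 0 \<le> f s" "\<And>s. f s \<le> 1"
  shows "measure_pmf.expectation p (\<lambda>s. log_mgf (f s)) \<le> log_mgf (measure_pmf.expectation p f)"
proof -
  let ?m = "measure_pmf.expectation p f"
  let ?D = "(exp 1 - 1) / (1 + (exp 1 - 1) * ?m)"
  have int: "integrable (measure_pmf p) f"
    using assms by (intro integrable_pmf_bounded[where C = 1]) auto
  have "measure_pmf.expectation p (\<lambda>s. log_mgf (f s))
      \<le> measure_pmf.expectation p (\<lambda>s. log_mgf ?m + ?D * (f s - ?m))"
  proof (rule integral_mono)
    show "integrable (measure_pmf p) (\<lambda>s. log_mgf (f s))"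
      using log_mgf_bounds[OF assms]
      by (intro integrable_pmf_bounded[where C = "exp 1 - 1"]) auto
    have "0 \<le> ?m" using assms by (intro integral_nonneg_AE) auto
    then show "log_mgf (f s) \<le> log_mgf ?m + ?D * (f s - ?m)" for s
      using assms by (intro log_mgf_tangent) auto
  qed (use int in auto)
  also have "\<dots> = log_mgf ?m"
    using int by simp
  finally show ?thesis .
qed

section \<open>The cost of a single comparison\<close>

text \<open>Donsker--Varadhan on a finite set, with the relative entropy of \<open>p\<close> with
  respect to \<open>q\<close> replaced by the larger chi-square divergence, which is a rational
  function of the scores.\<close>

lemma sum_log_mgf_change_of_measure:
  fixes p q y :: "'a \<Rightarrow> real"
  assumes S: "finite S" and p: "\<And>a. a \<in> S \<Longrightarrow> 0 < p a" "sum p S = 1"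
    and q: "\<And>a. a \<in> S \<Longrightarrow> 0 < q a" "sum q S = 1"
    and y: "\<And>a. a \<in> S \<Longrightarrow> 0 \<le> y a"
  shows "(\<Sum>a\<in>S. p a * log_mgf (y a))
           \<le> log_mgf (\<Sum>a\<in>S. q a * y a) + ((\<Sum>a\<in>S. (p a)\<^sup>2 / q a) - 1)"
proof -
  define v where "v a = 1 + (exp 1 - 1) * y a" for a
  define V where "V = 1 + (exp 1 - 1) * (\<Sum>a\<in>S. q a * y a)"
  have V: "0 < V" unfolding V_def
    using q(1) y by (intro log_mgf_arg_pos sum_nonneg mult_nonneg_nonneg) (auto intro: less_imp_le)
  have sumv: "(\<Sum>a\<in>S. q a * v a) = V"
    using q(2) by (simp add: v_def V_def distrib_left sum.distrib sum_distrib_left mult.left_commute)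
  have "p a * ln (v a) \<le> p a * ln V + ((p a)\<^sup>2 / q a - p a) + (q a * v a / V - p a)"
    if a: "a \<in> S" for a
  proof -
    have pq: "0 < p a" "0 < q a" "0 < v a"
      using a p q log_mgf_arg_pos[OF y] by (auto simp: v_def)
    \<comment> \<open>Here \<open>v / V = (p / q) * (q * v / (p * V))\<close>. The bound
      \<open>ln z \<le> z - 1\<close> on the second factor gives the variational inequality, since
      its \<open>p\<close>-average vanishes by \<open>sumv\<close>; on the first factor it gives the
      chi-square term.\<close>
    have "ln (q a * v a / (p a * V)) \<le> q a * v a / (p a * V) - 1"
      using pq V by (intro ln_le_minus_one) auto
    moreover have "ln (p a / q a) \<le> p a / q a - 1"
      using pq by (intro ln_le_minus_one) auto
    ultimately have "ln (v a) \<le> ln V + (p a / q a - 1) + (q a * v a / (p a * V) - 1)"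
      using pq V by (simp add: ln_div ln_mult)
    then have "p a * ln (v a)
        \<le> p a * (ln V + (p a / q a - 1) + (q a * v a / (p a * V) - 1))"
      using pq by (intro mult_left_mono) auto
    also have "\<dots> = p a * ln V + ((p a)\<^sup>2 / q a - p a) + (q a * v a / V - p a)"
      using pq V by (simp add: field_simps power2_eq_square)
    finally show ?thesis .
  qed
  then have "(\<Sum>a\<in>S. p a * ln (v a))
      \<le> (\<Sum>a\<in>S. p a * ln V + ((p a)\<^sup>2 / q a - p a) + (q a * v a / V - p a))"
    by (rule sum_mono)
  also have "\<dots> = ln V + ((\<Sum>a\<in>S. (p a)\<^sup>2 / q a) - 1)"
    using p(2) sumv V unfolding sum.distrib sum_subtractf
    by (simp flip: sum_distrib_right sum_divide_distrib)
  finally show ?thesis by (simp add: log_mgf_def v_def V_def)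
qed

text \<open>With \<open>d = w b - v\<close> and \<open>R\<close> the total score of the other items,
  the divergence equals \<open>(d / v)\<^sup>2 * (v * R / (v + d + R)\<^sup>2)\<close>. It is
  relaxed to a multiple of the probability that \<open>b\<close> wins, because such probabilities
  sum to at most 1 over different \<open>b\<close>.\<close>

lemma chi_square_lowered_score:
  fixes w :: "'a \<Rightarrow> real"
  assumes S: "finite S" and w: "\<And>a. a \<in> S \<Longrightarrow> 0 < w a" and b: "b \<in> S" and v: "0 < v" "v \<le> w b"
  shows "(\<Sum>a\<in>S. (w a / sum w S)\<^sup>2 / ((w(b := v)) a / sum (w(b := v)) S)) - 1
           \<le> ((w b - v) / v)\<^sup>2 * (w b / sum w S)"
proof -
  define R where "R = sum w (S - {b})"
  define d where "d = w b - v"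
  have wb: "w b = v + d" and d: "0 \<le> d" using v by (auto simp: d_def)
  have R: "0 \<le> R" unfolding R_def using w by (intro sum_nonneg) (auto intro: less_imp_le)
  have Z: "sum w S = v + d + R"
    using sum.remove[OF S b, of w] wb by (simp add: R_def)
  have Z': "sum (w(b := v)) S = v + R"
    using sum.remove[OF S b, of "w(b := v)"] by (simp add: R_def)
  have "(\<Sum>a\<in>S. (w a / sum w S)\<^sup>2 / ((w(b := v)) a / sum (w(b := v)) S))
      = (\<Sum>a\<in>S. (w a)\<^sup>2 / (w(b := v)) a) * ((v + R) / (v + d + R)\<^sup>2)"
    unfolding Z Z' sum_distrib_right by (intro sum.cong) (auto simp: power_divide)
  also have "(\<Sum>a\<in>S. (w a)\<^sup>2 / (w(b := v)) a) = (v + d)\<^sup>2 / v + (\<Sum>a\<in>S - {b}. (w a)\<^sup>2 / (w(b := v)) a)"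
    using sum.remove[OF S b, of "\<lambda>a. (w a)\<^sup>2 / (w(b := v)) a"] wb by simp
  also have "(\<Sum>a\<in>S - {b}. (w a)\<^sup>2 / (w(b := v)) a) = R"
    unfolding R_def
  proof (rule sum.cong)
    show "(w a)\<^sup>2 / (w(b := v)) a = w a" if "a \<in> S - {b}" for a
      using w[of a] that by (simp add: power2_eq_square)
  qed simp
  also have "((v + d)\<^sup>2 / v + R) * ((v + R) / (v + d + R)\<^sup>2) - 1 = (d / v)\<^sup>2 * (v * R / (v + d + R)\<^sup>2)"
  proof -
    have "v + d + R \<noteq> 0" using v d R by linarith
    then show ?thesis using v by (simp add: divide_simps) (simp add: algebra_simps power2_eq_square)
  qed
  also have "\<dots> \<le> (d / v)\<^sup>2 * ((v + d) / (v + d + R))"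
  proof (intro mult_left_mono)
    have "v * R \<le> (v + d) * (v + d + R)" using v d R by (intro mult_mono) auto
    then show "v * R / (v + d + R)\<^sup>2 \<le> (v + d) / (v + d + R)"
      using v d R by (simp add: power2_eq_square divide_simps)
  qed auto
  finally show ?thesis by (simp add: Z wb)
qed

lemma expectation_mnl_choice:
  fixes f :: "nat \<Rightarrow> real"
  assumes "finite S" "S \<noteq> {}" "\<And>j. j \<in> S \<Longrightarrow> 0 < w j"
  shows "measure_pmf.expectation (mnl_choice w S) f = (\<Sum>a\<in>S. w a / sum w S * f a)"
proof -
  have "measure_pmf.expectation (mnl_choice w S) f = (\<Sum>a\<in>S. pmf (mnl_choice w S) a * f a)"
    using assms by (subst integral_measure_pmf[of S]) (auto simp: set_pmf_iff pmf_mnl_choice)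
  then show ?thesis using assms by (simp add: pmf_mnl_choice)
qed

text \<open>The weights cancel the factor \<open>((w b - v) / v)\<^sup>2\<close> of the chi-square
  bound. What remains are the winning probabilities of the items of \<open>B\<close> in
  \<open>S\<close>; these belong to disjoint events, so the cost is at most 1 however large
  \<open>S\<close> is.\<close>

lemma comparison_cost:
  fixes w :: "nat \<Rightarrow> real"
  assumes S: "finite S" "S \<noteq> {}" "\<And>a. a \<in> S \<Longrightarrow> 0 < w a"
    and B: "finite B" and v: "0 < v" "\<And>b. b \<in> B \<Longrightarrow> v < w b"
    and g: "\<And>b a. 0 \<le> g b a"
  defines "p \<equiv> \<lambda>a. w a / sum w S"
  shows "(\<Sum>b\<in>B. (v / (w b - v))\<^sup>2 * (\<Sum>a\<in>S. p a * log_mgf (g b a)))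
     \<le> (\<Sum>b\<in>B. (v / (w b - v))\<^sup>2
          * log_mgf (measure_pmf.expectation (mnl_choice (w(b := v)) S) (g b))) + 1"
proof -
  have sump: "sum p S = 1" and p_pos: "\<And>a. a \<in> S \<Longrightarrow> 0 < p a"
    using S sum_pos[OF S(1,2), of w] by (auto simp: p_def simp flip: sum_divide_distrib)
  have "(v / (w b - v))\<^sup>2 * (\<Sum>a\<in>S. p a * log_mgf (g b a))
     \<le> (v / (w b - v))\<^sup>2 * log_mgf (measure_pmf.expectation (mnl_choice (w(b := v)) S) (g b))
        + (if b \<in> S then p b else 0)" if b: "b \<in> B" for b
  proof -
    define w' where "w' = w(b := v)"
    define q where "q a = w' a / sum w' S" for a
    have w': "\<And>a. a \<in> S \<Longrightarrow> 0 < w' a" using S(3) v(1) by (auto simp: w'_def)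
    have Z': "0 < sum w' S" using S w' by (intro sum_pos) auto
    have q: "\<And>a. a \<in> S \<Longrightarrow> 0 < q a" "sum q S = 1"
      using w' Z' by (auto simp: q_def simp flip: sum_divide_distrib)
    have E: "measure_pmf.expectation (mnl_choice w' S) (g b) = (\<Sum>a\<in>S. q a * g b a)"
      using S w' by (simp add: expectation_mnl_choice q_def)
    have wb: "v < w b" using v(2) b by auto
    have chi: "(v / (w b - v))\<^sup>2 * ((\<Sum>a\<in>S. (p a)\<^sup>2 / q a) - 1) \<le> (if b \<in> S then p b else 0)"
    proof (cases "b \<in> S")
      case True
      have "(\<Sum>a\<in>S. (p a)\<^sup>2 / q a) - 1 \<le> ((w b - v) / v)\<^sup>2 * p b"
        unfolding p_def q_def w'_def using S True v(1) wb
        by (intro chi_square_lowered_score) auto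
      then have "(v / (w b - v))\<^sup>2 * ((\<Sum>a\<in>S. (p a)\<^sup>2 / q a) - 1)
          \<le> (v / (w b - v))\<^sup>2 * (((w b - v) / v)\<^sup>2 * p b)"
        by (intro mult_left_mono) auto
      also have "\<dots> = p b" using wb v(1) by (simp add: power_divide)
      finally show ?thesis using True by simp
    next
      \<comment> \<open>A comparison without \<open>b\<close> has the same law in both models and
        costs nothing.\<close>
      case False
      have "q a = p a" if "a \<in> S" for a
      proof -
        have "w' a = w a" if "a \<in> S" for a using False that by (auto simp: w'_def)
        then show ?thesis using that by (simp add: q_def p_def)
      qed
      then have "(\<Sum>a\<in>S. (p a)\<^sup>2 / q a) = sum p S"
        by (intro sum.cong) (auto simp: power2_eq_square)
      then show ?thesis using False sump by simp
    qed
    have "(\<Sum>a\<in>S. p a * log_mgf (g b a))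
       \<le> log_mgf (\<Sum>a\<in>S. q a * g b a) + ((\<Sum>a\<in>S. (p a)\<^sup>2 / q a) - 1)"
      using S(1) p_pos sump q g by (intro sum_log_mgf_change_of_measure) auto
    then have "(v / (w b - v))\<^sup>2 * (\<Sum>a\<in>S. p a * log_mgf (g b a))
       \<le> (v / (w b - v))\<^sup>2 * (log_mgf (\<Sum>a\<in>S. q a * g b a) + ((\<Sum>a\<in>S. (p a)\<^sup>2 / q a) - 1))"
      by (intro mult_left_mono) auto
    then show ?thesis using chi unfolding E[symmetric] w'_def by (simp add: distrib_left)
  qed
  then have "(\<Sum>b\<in>B. (v / (w b - v))\<^sup>2 * (\<Sum>a\<in>S. p a * log_mgf (g b a)))
     \<le> (\<Sum>b\<in>B. (v / (w b - v))\<^sup>2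
          * log_mgf (measure_pmf.expectation (mnl_choice (w(b := v)) S) (g b))
        + (if b \<in> S then p b else 0))"
    by (rule sum_mono)
  moreover have "(\<Sum>b\<in>B. if b \<in> S then p b else 0) \<le> 1"
  proof -
    have "(\<Sum>b\<in>B. if b \<in> S then p b else 0) = sum p (B \<inter> S)"
      using B by (simp add: sum.inter_restrict)
    also have "\<dots> \<le> sum p S" using S p_pos by (intro sum_mono2) (auto intro: less_imp_le)
    finally show ?thesis using sump by simp
  qed
  ultimately show ?thesis by (simp add: sum.distrib)
qed

section \<open>Change of measure along an adaptive run\<close>

text \<open>Induction on the number of comparisons still allowed, each adding at most 1. All lowered
  models, one for each \<open>b\<close>, are treated together, since the bound 1 holds for the
  weighted sum of their costs.\<close>

lemma run_change_of_measure:
  fixes w :: "nat \<Rightarrow> real"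
  assumes valid: "valid_algorithm n A" and w: "\<And>j. j \<in> {1..n} \<Longrightarrow> 0 < w j"
    and B: "finite B" and v: "0 < v" "\<And>b. b \<in> B \<Longrightarrow> v < w b"
    and "reachable A h"
  shows "(\<Sum>b\<in>B. (v / (w b - v))\<^sup>2) * pmf (run A w t h) r
     \<le> (\<Sum>b\<in>B. (v / (w b - v))\<^sup>2 * log_mgf (pmf (run A (w(b := v)) t h) r)) + real t"
  using \<open>reachable A h\<close>
proof (induction t arbitrary: h)
  case 0
  define D where "D = run A w 0 h"
  \<comment> \<open>With no comparison left, the outcome does not depend on the scores.\<close>
  have "run A w' 0 h = D" for w' by (simp add: D_def)
  moreover have "(\<Sum>b\<in>B. (v / (w b - v))\<^sup>2) * pmf D r
     \<le> (\<Sum>b\<in>B. (v / (w b - v))\<^sup>2 * log_mgf (pmf D r))"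
    unfolding sum_distrib_right
    by (intro sum_mono mult_left_mono log_mgf_ge pmf_nonneg pmf_le_1) auto
  ultimately show ?case by (simp only: of_nat_0 add_0_right)
next
  case (Suc t)
  define \<beta> where "\<beta> b = (v / (w b - v))\<^sup>2" for b
  \<comment> \<open>\<open>U w' s\<close> is the law of the outcome once the next step
    \<open>s\<close> is fixed. The law \<open>A h\<close> of that step is the same in every
    model.\<close>
  define U where "U w' s = (case s of Answer R \<Rightarrow> return_pmf (Some R)
     | Compare S \<Rightarrow> bind_pmf (mnl_choice w' S) (\<lambda>a. run A w' t (h @ [(S, a)])))" for w' s
  have run: "pmf (run A w' (Suc t) h) r = measure_pmf.expectation (A h) (\<lambda>s. pmf (U w' s) r)" for w'
    by (simp add: pmf_bind U_def)
  have step: "sum \<beta> B * pmf (U w s) r \<le> (\<Sum>b\<in>B. \<beta> b * log_mgf (pmf (U (w(b := v)) s) r)) + Suc t"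
    if s: "s \<in> set_pmf (A h)" for s
  proof (cases s)
    case (Answer R)
    have "sum \<beta> B * pmf (return_pmf (Some R)) r
        \<le> (\<Sum>b\<in>B. \<beta> b * log_mgf (pmf (return_pmf (Some R)) r))"
      unfolding sum_distrib_right
      by (intro sum_mono mult_left_mono log_mgf_ge pmf_nonneg pmf_le_1) (auto simp: \<beta>_def)
    then show ?thesis by (simp add: Answer U_def)
  next
    case (Compare S)
    have S: "S \<subseteq> {1..n}" "2 \<le> card S"
      using valid Suc.prems s Compare by (auto simp: valid_algorithm_def)
    then have S': "finite S" "S \<noteq> {}" "\<And>a. a \<in> S \<Longrightarrow> 0 < w a"
      using w finite_subset[of S "{1..n}"] by auto
    define p where "p a = w a / sum w S" for a
    have Z: "0 < sum w S" using S' by (intro sum_pos) auto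
    have sump: "sum p S = 1" and p0: "\<And>a. a \<in> S \<Longrightarrow> 0 \<le> p a"
      using S' Z by (auto simp: p_def less_imp_le simp flip: sum_divide_distrib)
    let ?u = "\<lambda>w' a. pmf (run A w' t (h @ [(S, a)])) r"
    have U_Compare: "pmf (U w' s) r = measure_pmf.expectation (mnl_choice w' S) (?u w')" for w'
      by (simp add: Compare U_def pmf_bind)
    have IH: "sum \<beta> B * ?u w a \<le> (\<Sum>b\<in>B. \<beta> b * log_mgf (?u (w(b := v)) a)) + real t"
      if "a \<in> S" for a
      unfolding \<beta>_def using Suc.prems s Compare that
      by (intro Suc.IH reachable.snoc) auto
    have "sum \<beta> B * pmf (U w s) r = (\<Sum>a\<in>S. p a * (sum \<beta> B * ?u w a))"
      using S' by (simp add: Compare U_def pmf_bind expectation_mnl_choice p_def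
        sum_distrib_left mult.left_commute)
    \<comment> \<open>The induction hypothesis is averaged over winners drawn from the true model;
      \<open>comparison_cost\<close> then moves this average to the lowered models.\<close>
    also have "\<dots> \<le> (\<Sum>a\<in>S. p a * ((\<Sum>b\<in>B. \<beta> b * log_mgf (?u (w(b := v)) a)) + real t))"
      using IH p0 by (intro sum_mono mult_left_mono)
    also have "\<dots> = (\<Sum>a\<in>S. \<Sum>b\<in>B. \<beta> b * (p a * log_mgf (?u (w(b := v)) a))) + real t"
      using sump by (simp add: distrib_left sum.distrib sum_distrib_left mult.left_commute
        flip: sum_distrib_right)
    also have "(\<Sum>a\<in>S. \<Sum>b\<in>B. \<beta> b * (p a * log_mgf (?u (w(b := v)) a)))
        = (\<Sum>b\<in>B. \<beta> b * (\<Sum>a\<in>S. p a * log_mgf (?u (w(b := v)) a)))"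
      by (subst sum.swap) (simp add: sum_distrib_left)
    also have "\<dots> \<le> (\<Sum>b\<in>B. \<beta> b * log_mgf (pmf (U (w(b := v)) s) r)) + 1"
      unfolding \<beta>_def p_def U_Compare by (rule comparison_cost[OF S' B v pmf_nonneg])
    finally show ?thesis by simp
  qed
  have U01: "0 \<le> pmf (U w' s) r" "pmf (U w' s) r \<le> 1" for w' s
    by (simp_all add: pmf_le_1)
  have int_U: "integrable (measure_pmf (A h)) (\<lambda>s. pmf (U w' s) r)" for w'
    using U01 by (intro integrable_pmf_bounded[where C = 1]) auto
  have int_log: "integrable (measure_pmf (A h)) (\<lambda>s. log_mgf (pmf (U w' s) r))" for w'
    using log_mgf_bounds[OF U01] by (intro integrable_pmf_bounded[where C = "exp 1 - 1"]) auto
  have "sum \<beta> B * pmf (run A w (Suc t) h) r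
      = measure_pmf.expectation (A h) (\<lambda>s. sum \<beta> B * pmf (U w s) r)"
    by (simp add: run del: run.simps)
  also have "\<dots> \<le> measure_pmf.expectation (A h)
      (\<lambda>s. (\<Sum>b\<in>B. \<beta> b * log_mgf (pmf (U (w(b := v)) s) r)) + Suc t)"
    using int_U int_log step
    by (intro integral_mono_AE Bochner_Integration.integrable_add
        Bochner_Integration.integrable_sum integrable_mult_right) (auto simp: AE_measure_pmf_iff)
  also have "\<dots> = (\<Sum>b\<in>B. \<beta> b * measure_pmf.expectation (A h)
      (\<lambda>s. log_mgf (pmf (U (w(b := v)) s) r))) + Suc t"
    using int_log by (simp add: Bochner_Integration.integral_add Bochner_Integration.integral_sum)
  \<comment> \<open>Jensen absorbs the algorithm's own randomness at no cost.\<close>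
  also have "\<dots> \<le> (\<Sum>b\<in>B. \<beta> b * log_mgf (pmf (run A (w(b := v)) (Suc t) h) r)) + Suc t"
    unfolding run
    by (intro add_right_mono sum_mono mult_left_mono expectation_log_mgf_le U01)
      (auto simp: \<beta>_def)
  finally show ?case unfolding \<beta>_def .
qed

section \<open>Exchangeability of two labels\<close>

lemma pmf_two_le_1:
  assumes "x \<noteq> y"
  shows "pmf M x + pmf M y \<le> 1"
proof -
  have "pmf M x + pmf M y = measure (measure_pmf M) {x, y}"
    using assms by (simp add: measure_measure_pmf_finite)
  then show ?thesis by simp
qed

text \<open>After lowering, swapping the labels of \<open>i\<close> and \<open>m\<close> does not change the model but
  makes a different answer correct.\<close>

lemma sum_lowered_success_le:
  fixes \<theta> :: "nat \<Rightarrow> real"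
  assumes i: "i \<in> {1..k}" and m: "m \<in> {1..n}" "m \<notin> {1..k}" and k: "k \<le> n"
  shows "2 * (\<Sum>\<pi> | \<pi> permutes {1..n}.
      pmf (run A ((\<lambda>j. \<theta> (inv \<pi> j))(\<pi> i := \<theta> m)) T []) (Some (\<pi> ` {1..k})))
    \<le> card {\<pi>. \<pi> permutes {1..n}}"
proof -
  define \<tau> where "\<tau> = Transposition.transpose i m"
  have \<tau>: "\<tau> permutes {1..n}"
    unfolding \<tau>_def using i m k by (intro permutes_swap_id) auto
  define W where "W \<pi> = (\<lambda>j. \<theta> (inv \<pi> j))(\<pi> i := \<theta> m)" for \<pi> :: "nat \<Rightarrow> nat"
  define F where "F \<pi> = pmf (run A (W \<pi>) T []) (Some (\<pi> ` {1..k}))" for \<pi> :: "nat \<Rightarrow> nat"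
  have pair: "F \<pi> + F (\<pi> \<circ> \<tau>) \<le> 1" if "\<pi> permutes {1..n}" for \<pi>
  proof -
    have bij: "bij \<pi>" using that by (rule permutes_bij)
    have inv_comp: "inv (\<pi> \<circ> \<tau>) = \<tau> \<circ> inv \<pi>"
      using bij \<tau> by (simp add: o_inv_distrib permutes_bij \<tau>_def)
    have "W (\<pi> \<circ> \<tau>) = W \<pi>"
    proof
      fix j
      \<comment> \<open>Seen from the items, \<open>W\<close> lowers item \<open>i\<close>, so items
        \<open>i\<close> and \<open>m\<close> both score \<open>\<theta> m\<close> and composing
        with \<open>\<tau>\<close> is invisible.\<close>
      have W: "W \<rho> j = (if inv \<rho> j = i then \<theta> m else \<theta> (inv \<rho> j))" if "\<rho> permutes {1..n}" for \<rho>
        using permutes_inv_eq[OF that, of j i] by (auto simp: W_def)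
      show "W (\<pi> \<circ> \<tau>) j = W \<pi> j"
        unfolding W[OF that] W[OF permutes_compose[OF \<tau> that]] inv_comp comp_apply
        by (simp add: \<tau>_def Transposition.transpose_def)
    qed
    moreover have "\<pi> ` {1..k} \<noteq> (\<pi> \<circ> \<tau>) ` {1..k}"
    proof
      assume "\<pi> ` {1..k} = (\<pi> \<circ> \<tau>) ` {1..k}"
      then have "\<pi> m \<in> \<pi> ` {1..k}"
        using i by (auto simp: \<tau>_def image_iff Transposition.transpose_def)
      then show False using m(2) bij_is_inj[OF bij] by (simp only: inj_image_mem_iff)
    qed
    ultimately show ?thesis
      by (simp add: F_def pmf_two_le_1)
  qed
  \<comment> \<open>Composition with \<open>\<tau>\<close> permutes the labelings, so both summands
    have the same total.\<close>
  have "2 * sum F {\<pi>. \<pi> permutes {1..n}}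
      = (\<Sum>\<pi> | \<pi> permutes {1..n}. F \<pi> + F (\<pi> \<circ> \<tau>))"
    using sum_permutations_compose_right[OF \<tau>, of F] by (simp add: sum.distrib)
  also have "\<dots> \<le> (\<Sum>\<pi> | \<pi> permutes {1..n}. 1)"
    using pair by (intro sum_mono) auto
  finally show ?thesis by (simp add: F_def W_def)
qed

section \<open>Averaging over the labelings\<close>

lemma prob_success_pmf:
  "measure_pmf.prob (success_pmf n k \<theta> A T) {True}
     = (\<Sum>\<pi> | \<pi> permutes {1..n}. pmf (run A (\<lambda>j. \<theta> (inv \<pi> j)) T []) (Some (\<pi> ` {1..k})))
         / card {\<pi>. \<pi> permutes {1..n}}"
proof -
  have P: "{\<pi>. \<pi> permutes {1..n}} \<noteq> {}" "finite {\<pi>. \<pi> permutes {1..n}}"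
    using permutes_id[of "{1..n}"] finite_permutations[of "{1..n}"] by (blast, simp)
  have "pmf (map_pmf (\<lambda>r. r = x) M) True = pmf M x" for M :: "nat set option pmf" and x
    by (simp add: pmf_map vimage_def measure_pmf_single)
  then show ?thesis
    using P by (simp add: success_pmf_def measure_pmf_single pmf_bind integral_pmf_of_set)
qed

theorem theorem5:
  fixes n k T :: nat and \<theta> :: "nat \<Rightarrow> real" and c :: real and A :: algorithm
  assumes "1 \<le> k" and "k < n"
    and "\<And>i. i \<in> {1..n} \<Longrightarrow> \<theta> i > 0"
    and "\<And>i j. 1 \<le> i \<Longrightarrow> i \<le> j \<Longrightarrow> j \<le> n \<Longrightarrow> \<theta> j \<le> \<theta> i"
    and "\<theta> k > \<theta> (k + 1)"
    and "c < 4 / 10 ^ 4"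
    and "valid_algorithm n A"
    and "uses_at_most A T"
    and "real T \<le> c * (\<Sum>i | i \<in> {1..k} \<and> \<theta> i \<le> 2 * \<theta> (k + 1).
                         (\<theta> (k + 1))\<^sup>2 / (\<theta> (k + 1) - \<theta> i)\<^sup>2)"
  shows "measure_pmf.prob (success_pmf n k \<theta> A T) {True} \<le> 7 / 8"
proof -
  define q where "q = \<theta> (k + 1)"
  define \<beta> where "\<beta> i = (q / (\<theta> i - q))\<^sup>2" for i
  define P where "P = {\<pi>. \<pi> permutes {1..n}}"
  define u where "u \<pi> = pmf (run A (\<lambda>j. \<theta> (inv \<pi> j)) T []) (Some (\<pi> ` {1..k}))" for \<pi>
  define u' where "u' i \<pi> = pmf (run A ((\<lambda>j. \<theta> (inv \<pi> j))(\<pi> i := q)) T []) (Some (\<pi> ` {1..k}))"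
    for i \<pi>
  let ?W = "sum \<beta> {1..k}"
  have q: "0 < q" using assms(2,3) by (simp add: q_def)
  have gap: "q < \<theta> i" if "i \<in> {1..k}" for i
    using assms(4)[of i k] assms(2,5) that by (auto simp: q_def)
  have "finite P" "id \<in> P" unfolding P_def using permutes_id by (auto intro: finite_permutations)
  then have card_P: "0 < card P" by (auto simp: card_gt_0_iff)
  have W: "0 < ?W"
  proof (rule sum_pos)
    show "0 < \<beta> i" if "i \<in> {1..k}" for i
      using gap[OF that] q by (simp add: \<beta>_def)
  qed (use assms(1) in auto)
  \<comment> \<open>The terms are nonnegative, so the sum over near items may be extended to all top
    items. The constant \<open>c\<close> may be negative; only its upper bound enters.\<close>
  have T: "real T \<le> 4 / 10 ^ 4 * ?W"
  proof -
    have \<beta>_alt: "(\<theta> (k + 1))\<^sup>2 / (\<theta> (k + 1) - \<theta> i)\<^sup>2 = \<beta> i" for i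
      by (simp add: \<beta>_def q_def power_divide power2_commute)
    let ?V = "\<Sum>i | i \<in> {1..k} \<and> \<theta> i \<le> 2 * \<theta> (k + 1). \<beta> i"
    have "0 \<le> ?V" by (intro sum_nonneg) (simp add: \<beta>_def)
    then have "c * ?V \<le> 4 / 10 ^ 4 * ?V"
      using assms(6) by (intro mult_right_mono) auto
    also have "\<dots> \<le> 4 / 10 ^ 4 * ?W"
      by (intro mult_left_mono sum_mono2) (auto simp: \<beta>_def)
    finally show ?thesis using assms(9) unfolding \<beta>_alt by linarith
  qed
  \<comment> \<open>For a fixed labeling, \<open>B\<close> is the set of labels of the top items.
    Making the bound linear in \<open>u'\<close> lets the sum over \<open>\<pi>\<close> reach the
    exchangeability bound \<open>half\<close>.\<close>
  have pointwise: "?W * u \<pi> \<le> (\<Sum>i\<in>{1..k}. \<beta> i * ((exp 1 - 1) * u' i \<pi>)) + real T"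
    if "\<pi> \<in> P" for \<pi>
  proof -
    have \<pi>: "\<pi> permutes {1..n}" using that by (simp add: P_def)
    have inj: "inj_on \<pi> {1..k}" using permutes_inj[OF \<pi>] by (rule inj_on_subset) simp
    have inv: "inv \<pi> (\<pi> i) = i" for i by (rule inv_f_f[OF permutes_inj[OF \<pi>]])
    have pos: "0 < \<theta> (inv \<pi> j)" if "j \<in> {1..n}" for j
      by (rule assms(3)) (simp only: permutes_in_image[OF permutes_inv[OF \<pi>]] that)
    have gap': "q < \<theta> (inv \<pi> b)" if "b \<in> \<pi> ` {1..k}" for b
      using that gap by (elim imageE) (simp only: inv)
    have "?W * u \<pi> \<le> (\<Sum>i\<in>{1..k}. \<beta> i * log_mgf (u' i \<pi>)) + real T"
      using run_change_of_measure[where w = "\<lambda>j. \<theta> (inv \<pi> j)" and B = "\<pi> ` {1..k}" and v = q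
          and t = T and r = "Some (\<pi> ` {1..k})", OF assms(7) pos _ q gap' reachable.Nil]
      unfolding sum.reindex[OF inj] comp_apply inv \<beta>_def u_def u'_def by blast
    also have "\<dots> \<le> (\<Sum>i\<in>{1..k}. \<beta> i * ((exp 1 - 1) * u' i \<pi>)) + real T"
      by (intro add_right_mono sum_mono mult_left_mono log_mgf_le) (auto simp: \<beta>_def u'_def)
    finally show ?thesis .
  qed
  have half: "sum (u' i) P \<le> card P / 2" if "i \<in> {1..k}" for i
    using sum_lowered_success_le[OF that, of "k + 1" n A \<theta> T] assms(2)
    by (simp add: u'_def P_def q_def)
  have "?W * sum u P \<le> (\<Sum>\<pi>\<in>P. (\<Sum>i\<in>{1..k}. \<beta> i * ((exp 1 - 1) * u' i \<pi>)) + real T)"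
    unfolding sum_distrib_left by (intro sum_mono pointwise)
  also have "\<dots> = (\<Sum>i\<in>{1..k}. \<beta> i * ((exp 1 - 1) * sum (u' i) P)) + card P * real T"
    by (simp add: sum.distrib sum_distrib_left sum.swap[of _ P])
  also have "\<dots> \<le> (\<Sum>i\<in>{1..k}. \<beta> i * ((exp 1 - 1) * (card P / 2))) + card P * (4 / 10 ^ 4 * ?W)"
    using half T by (intro add_mono sum_mono mult_left_mono) (auto simp: \<beta>_def)
  also have "\<dots> = ?W * (card P * ((exp 1 - 1) / 2 + 4 / 10 ^ 4))"
    unfolding sum_distrib_right[symmetric] by (simp add: algebra_simps)
  finally have "sum u P \<le> card P * ((exp 1 - 1) / 2 + 4 / 10 ^ 4)"
    using W by simp
  also have "\<dots> \<le> card P * (7 / 8)"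
  proof (rule mult_left_mono)
    \<comment> \<open>Since \<open>exp 1 < 2.72\<close>, the left side is below 0.8604.\<close>
    show "(exp 1 - 1) / 2 + 4 / 10 ^ 4 \<le> (7 / 8 :: real)"
      using e_less_272 by (simp add: field_simps)
  qed simp
  finally show ?thesis
    using card_P by (simp add: prob_success_pmf u_def P_def field_simps)
qed

end
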